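(* Let $M\ge 1$ and let $\phi_1,\dots,\phi_M$ be real- or complex-valued functions on $[-1,1]$ which are square integrable, i.e. $\int_{-1}^{1}|\phi_i(t)|^2\,dt<\infty$ for each $i$. Define the $M\times M$ matrix-valued function $\Phi$ on $\mathbb{R}$ by $$\Phi_{ij}(t)=\frac12\int_{-1}^{1-2\min\{|t|,1\}}\Big(\phi_i^*(x)\,\phi_j(x+2|t|)+\phi_j(x)\,\phi_i^*(x+2|t|)\Big)\,dx .$$ Then for every real $M\times M$ positive semi-definite matrix $A$, the function $$K_A(t)=\operatorname{Tr}\{A\,\Phi(t)\},\qquad t\in\mathbb{R},$$ is a compact positive-definite kernel supported on $[-1,1]$.
   Context: Here ${}^*$ denotes complex conjugation, and real positive semi-definite matrices are understood to be symmetric. A (translation-invariant) positive-definite kernel on $\mathbb{R}$ is a function $K:\mathbb{R}\to\mathbb{R}$ such that for every finite collection of points $x_1,\dots,x_n\in\mathbb{R}$ the matrix $\big(K(x_i-x_j)\big)_{i,j=1}^n$ is (symmetric) positive semi-definite. "Compact, supported on $[-1,1]$" means $K(t)=0$ for all $t\notin[-1,1]$. For $|t|\ge 1$ the upper limit of the integral defining $\Phi_{ij}(t)$ equals $-1$, so the integral is $0$. *)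

theory Defs
  imports "HOL-Analysis.Analysis"
begin

text \<open>
  Real matrices are indexed here by a finite set \<open>I\<close>, so that the same notion applies both to
  matrices of a fixed size (\<open>I = UNIV\<close>) and to the matrices \<open>K (x i - x j)\<close> for arbitrarily many points.
\<close>
definition pos_semidef_on :: "'i set \<Rightarrow> ('i \<Rightarrow> 'i \<Rightarrow> real) \<Rightarrow> bool" where
  "pos_semidef_on I A \<longleftrightarrow>
     (\<forall>i\<in>I. \<forall>j\<in>I. A i j = A j i) \<and>
     (\<forall>v. 0 \<le> (\<Sum>i\<in>I. \<Sum>j\<in>I. v i * A i j * v j))"

definition pos_def_kernel :: "(real \<Rightarrow> real) \<Rightarrow> bool" where
  "pos_def_kernel K \<longleftrightarrow>
     (\<forall>(n::nat) (x :: nat \<Rightarrow> real). pos_semidef_on {..<n} (\<lambda>i j. K (x i - x j)))"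

definition square_integrable_on :: "(real \<Rightarrow> complex) \<Rightarrow> real set \<Rightarrow> bool" where
  "square_integrable_on f S \<longleftrightarrow>
     set_borel_measurable lebesgue S f \<and> set_integrable lebesgue S (\<lambda>x. (cmod (f x))\<^sup>2)"

text \<open>
  For \<open>\<bar>t\<bar> \<le> 1\<close> the integrand only evaluates \<open>\<phi>\<close> on \<open>{-1..1}\<close>; for \<open>\<bar>t\<bar> \<ge> 1\<close> the domain of
  integration is \<open>{-1}\<close>. Hence the values of \<open>\<phi>\<close> outside \<open>{-1..1}\<close> do not matter.
\<close>
definition Phi :: "('m::finite \<Rightarrow> real \<Rightarrow> complex) \<Rightarrow> real \<Rightarrow> complex^'m^'m" where
  "Phi \<phi> t = (\<chi> i j. 1 / 2 *
     (LINT x:{-1 .. 1 - 2 * min \<bar>t\<bar> 1}|lebesgue.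
        cnj (\<phi> i x) * \<phi> j (x + 2 * \<bar>t\<bar>) + \<phi> j x * cnj (\<phi> i (x + 2 * \<bar>t\<bar>))))"

definition trace_kernel ::
    "('m::finite \<Rightarrow> real \<Rightarrow> complex) \<Rightarrow> real^'m^'m \<Rightarrow> real \<Rightarrow> complex" where
  "trace_kernel \<phi> A t = trace (map_matrix complex_of_real A ** Phi \<phi> t)"

end

theory Submission
  imports Defs
begin

text \<open>
  Extend the \<open>\<phi> i\<close> by zero to functions \<open>F i\<close> on the whole line and let
  \<open>B s = (\<Sum>i j. A i j * \<integral> cnj (F i x) * F j (x + s) dx)\<close>. Symmetry of \<open>A\<close> gives
  \<open>B (-s) = cnj (B s)\<close>, and the kernel is \<open>K t = (B (2 * t) + B (- 2 * t)) / 2 = Re (B (2 * t))\<close>.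
  By translation invariance of the integral, \<open>\<Sum>k l. v k * v l * B (2 * (x k - x l))\<close> is the integral
  of \<open>\<Sum>i j. A i j * cnj (G i y) * G j y\<close> with \<open>G i y = (\<Sum>k. v k * F i (y - 2 * x k))\<close>, and this
  integrand is nonnegative at every \<open>y\<close>.
\<close>

lemma square_integrable_on_UNIV:
  "square_integrable_on f UNIV \<longleftrightarrow>
     f \<in> borel_measurable lebesgue \<and> integrable lebesgue (\<lambda>x. (cmod (f x))\<^sup>2)"
  by (simp add: square_integrable_on_def set_borel_measurable_def set_integrable_def)

lemma square_integrable_on_UNIV_zero_extension:
  assumes "square_integrable_on f S"
  shows "square_integrable_on (\<lambda>x. indicator S x *\<^sub>R f x) UNIV"
proof -
  have "(\<lambda>x. (cmod (indicator S x *\<^sub>R f x))\<^sup>2) = (\<lambda>x. indicator S x *\<^sub>R (cmod (f x))\<^sup>2)"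
    by (auto simp: indicator_def)
  then show ?thesis
    using assms unfolding square_integrable_on_UNIV
    by (simp add: square_integrable_on_def set_borel_measurable_def set_integrable_def)
qed

lemma square_integrable_on_UNIV_translation:
  assumes "square_integrable_on f UNIV"
  shows "square_integrable_on (\<lambda>x. f (x + a)) UNIV"
  using assms borel_measurable_affine[of f 1 a]
    lebesgue_integrable_real_affine[of "\<lambda>x. (cmod (f x))\<^sup>2" 1 a]
  by (simp add: square_integrable_on_UNIV add.commute)

text \<open>The product is dominated pointwise through
  \<open>2 * a * b \<le> a\<^sup>2 + b\<^sup>2\<close>. This is what allows finite sums to be
  exchanged with integrals later.\<close>

lemma integrable_cnj_mult:
  assumes "square_integrable_on f UNIV" "square_integrable_on g UNIV"
  shows "integrable lebesgue (\<lambda>x. cnj (f x) * g x)"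
proof (rule Bochner_Integration.integrable_bound)
  show "integrable lebesgue (\<lambda>x. (cmod (f x))\<^sup>2 + (cmod (g x))\<^sup>2)"
    using assms by (simp add: square_integrable_on_UNIV)
  have [measurable]: "f \<in> borel_measurable lebesgue" "g \<in> borel_measurable lebesgue"
    using assms by (auto simp: square_integrable_on_UNIV)
  have [measurable]: "cnj \<in> borel_measurable borel"
    by (intro borel_measurable_continuous_onI continuous_intros)
  show "(\<lambda>x. cnj (f x) * g x) \<in> borel_measurable lebesgue"
    by measurable
  have "a * b \<le> \<bar>a\<^sup>2 + b\<^sup>2\<bar>" for a b :: real
    using sum_squares_bound[of a b] sum_power2_ge_zero[of a b] by linarith
  then show "AE x in lebesgue. norm (cnj (f x) * g x) \<le> norm ((cmod (f x))\<^sup>2 + (cmod (g x))\<^sup>2)"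
    by (simp add: norm_mult)
qed

lemma integral_lebesgue_translation:
  fixes f :: "real \<Rightarrow> complex"
  shows "(LINT x|lebesgue. f (x + a)) = (LINT x|lebesgue. f x)"
  using lebesgue_integral_real_affine[of 1 f a] by (simp add: add.commute)

text \<open>The cross-correlation over the whole line: for functions extended by zero, a shift no
  longer moves the limits of integration.\<close>

definition correlation :: "(real \<Rightarrow> complex) \<Rightarrow> (real \<Rightarrow> complex) \<Rightarrow> real \<Rightarrow> complex" where
  "correlation f g s = (LINT x|lebesgue. cnj (f x) * g (x + s))"

text \<open>A translation by \<open>a\<close> turns the lag \<open>a - b\<close> into one separate
  shift per factor, so that sums over pairs of points can later be factored.\<close>

lemma correlation_diff:
  "correlation f g (a - b) = (LINT x|lebesgue. cnj (f (x - a)) * g (x - b))"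
  using integral_lebesgue_translation[of "\<lambda>x. cnj (f x) * g (x + (a - b))" "- a"]
  by (simp add: correlation_def)

text \<open>Conjugation exchanges the two factors, and a translation moves the shift to the other
  one.\<close>

lemma cnj_correlation: "cnj (correlation f g s) = correlation g f (- s)"
proof -
  have "cnj (correlation f g s) = (LINT x|lebesgue. cnj (g (x + s)) * f x)"
    unfolding correlation_def
    by (subst Bochner_Integration.integral_cnj[symmetric]) (simp add: mult.commute)
  then show ?thesis
    using correlation_diff[of g f "- s" 0] by simp
qed

text \<open>With the shift on the conjugated factor, this is the shape of the second summand in the
  integrand of \<open>Phi\<close>.\<close>

lemma correlation_minus: "correlation f g (- s) = (LINT x|lebesgue. g x * cnj (f (x + s)))"
  using correlation_diff[of f g "- s" 0] by (simp add: mult.commute)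

text \<open>No two points of an interval of length 2 are more than 2 apart.\<close>

lemma correlation_eq_0:
  assumes "\<And>x. x \<notin> {-1..1} \<Longrightarrow> f x = 0" "\<And>x. x \<notin> {-1..1} \<Longrightarrow> g x = 0" and "\<bar>s\<bar> > 2"
  shows "correlation f g s = 0"
proof -
  have "cnj (f x) * g (x + s) = 0" for x
    using assms(1)[of x] assms(2)[of "x + s"] \<open>\<bar>s\<bar> > 2\<close> by fastforce
  then show ?thesis
    unfolding correlation_def by (simp only: Bochner_Integration.integral_zero)
qed

lemma integrable_correlation:
  assumes "square_integrable_on f UNIV" "square_integrable_on g UNIV"
  shows "integrable lebesgue (\<lambda>x. cnj (f (x + a)) * g (x + b))"
  using assms by (intro integrable_cnj_mult square_integrable_on_UNIV_translation)

text \<open>The zero extensions absorb the limits of integration, so the two summands of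
  \<open>Phi\<close> become correlations at opposite lags. Their average is even in the lag, which
  removes the absolute value of \<open>t\<close>.\<close>

lemma Phi_eq_correlation:
  fixes \<phi> :: "'m::finite \<Rightarrow> real \<Rightarrow> complex"
  assumes "\<And>i. square_integrable_on (\<phi> i) {-1..1}"
  defines "F \<equiv> \<lambda>i x. indicator {-1..1} x *\<^sub>R \<phi> i x"
  shows "Phi \<phi> t $ i $ j = (correlation (F i) (F j) (2 * t) + correlation (F i) (F j) (- (2 * t))) / 2"
proof -
  have sq: "square_integrable_on (F i) UNIV" for i
    unfolding F_def by (intro square_integrable_on_UNIV_zero_extension assms)
  define s where "s = 2 * \<bar>t\<bar>"
  have "Phi \<phi> t $ i $ j = (correlation (F i) (F j) s + correlation (F i) (F j) (- s)) / 2"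
  proof (cases "\<bar>t\<bar> \<le> 1")
    case True
    \<comment> \<open>The interval consists exactly of those \<open>x\<close> for which
      \<open>x\<close> and \<open>x + s\<close> both lie in \<open>{-1..1}\<close>.\<close>
    have "indicator {-1 .. 1 - 2 * min \<bar>t\<bar> 1} x *\<^sub>R
        (cnj (\<phi> i x) * \<phi> j (x + 2 * \<bar>t\<bar>) + \<phi> j x * cnj (\<phi> i (x + 2 * \<bar>t\<bar>))) =
        cnj (F i x) * F j (x + s) + F j x * cnj (F i (x + s))" for x
      using True by (auto simp: F_def s_def indicator_def)
    then have "Phi \<phi> t $ i $ j =
        (LINT x|lebesgue. cnj (F i x) * F j (x + s) + F j x * cnj (F i (x + s))) / 2"
      by (simp add: Phi_def set_lebesgue_integral_def)
    also have "\<dots> = (correlation (F i) (F j) s + correlation (F i) (F j) (- s)) / 2"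
      using integrable_correlation[OF sq sq, of i 0 j s] integrable_correlation[OF sq sq, of i s j 0]
      unfolding correlation_minus unfolding correlation_def
      by (subst Bochner_Integration.integral_add) (simp_all add: mult.commute)
    finally show ?thesis .
  next
    case False
    \<comment> \<open>For \<open>\<bar>t\<bar> > 1\<close> the \<open>min\<close> leaves the domain
      \<open>{-1}\<close>. The integrand need not vanish there, but the point is a null set.\<close>
    have "(LINT x:{-1::real}|lebesgue. h x) = 0" for h :: "real \<Rightarrow> complex"
    proof -
      have "(\<lambda>x. indicator {-1} x *\<^sub>R h x) = (\<lambda>x. indicator {-1} x *\<^sub>R h (-1))"
        by (auto simp: indicator_def)
      then show ?thesis
        by (simp add: set_lebesgue_integral_def)
    qed
    then have "Phi \<phi> t $ i $ j = 0"
      using False by (simp add: Phi_def)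
    moreover have "correlation (F i) (F j) s = 0" "correlation (F i) (F j) (- s) = 0"
      using False by (auto intro!: correlation_eq_0 simp: F_def s_def)
    ultimately show ?thesis
      by simp
  qed
  then show ?thesis
    by (cases "t \<ge> 0") (auto simp: s_def add.commute)
qed

text \<open>As \<open>A\<close> is real, \<open>Re (cnj z * w) = Re z * Re w + Im z * Im w\<close>
  splits the form into two real quadratic forms.\<close>

lemma pos_semidef_on_complex:
  fixes A :: "'i \<Rightarrow> 'i \<Rightarrow> real" and g :: "'i \<Rightarrow> complex"
  assumes "pos_semidef_on I A"
  shows "0 \<le> Re (\<Sum>i\<in>I. \<Sum>j\<in>I. of_real (A i j) * (cnj (g i) * g j))"
proof -
  have "Re (\<Sum>i\<in>I. \<Sum>j\<in>I. of_real (A i j) * (cnj (g i) * g j)) =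
      (\<Sum>i\<in>I. \<Sum>j\<in>I. Re (g i) * A i j * Re (g j)) + (\<Sum>i\<in>I. \<Sum>j\<in>I. Im (g i) * A i j * Im (g j))"
    by (simp add: sum.distrib[symmetric] algebra_simps)
  also have "\<dots> \<ge> 0"
    using assms by (intro add_nonneg_nonneg) (auto simp: pos_semidef_on_def)
  finally show ?thesis .
qed

text \<open>The function \<open>B\<close> of the overview.\<close>

definition form_correlation ::
    "real^'m^'m \<Rightarrow> ('m::finite \<Rightarrow> real \<Rightarrow> complex) \<Rightarrow> real \<Rightarrow> complex" where
  "form_correlation A F s = (\<Sum>i\<in>UNIV. \<Sum>j\<in>UNIV. of_real (A $ i $ j) * correlation (F i) (F j) s)"

text \<open>Conjugating each correlation transposes the pair \<open>i\<close>, \<open>j\<close>; the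
  symmetry of \<open>A\<close> and an exchange of the sums undo this.\<close>

lemma cnj_form_correlation:
  assumes "\<And>i j. A $ i $ j = A $ j $ i"
  shows "cnj (form_correlation A F s) = form_correlation A F (- s)"
proof -
  have "cnj (form_correlation A F s) =
      (\<Sum>i\<in>UNIV. \<Sum>j\<in>UNIV. of_real (A $ j $ i) * correlation (F j) (F i) (- s))"
    by (simp add: form_correlation_def cnj_correlation assms)
  also have "\<dots> = form_correlation A F (- s)"
    unfolding form_correlation_def by (rule sum.swap)
  finally show ?thesis .
qed

lemma sum_swap_pairs:
  "(\<Sum>k\<in>K. \<Sum>l\<in>L. \<Sum>i\<in>I. \<Sum>j\<in>J. h k l i j) = (\<Sum>i\<in>I. \<Sum>j\<in>J. \<Sum>k\<in>K. \<Sum>l\<in>L. h k l i j)"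
proof -
  have "(\<Sum>k\<in>K. \<Sum>l\<in>L. \<Sum>i\<in>I. \<Sum>j\<in>J. h k l i j) = (\<Sum>k\<in>K. \<Sum>i\<in>I. \<Sum>l\<in>L. \<Sum>j\<in>J. h k l i j)"
    by (rule sum.cong[OF refl], rule sum.swap)
  also have "\<dots> = (\<Sum>i\<in>I. \<Sum>k\<in>K. \<Sum>l\<in>L. \<Sum>j\<in>J. h k l i j)"
    by (rule sum.swap)
  also have "\<dots> = (\<Sum>i\<in>I. \<Sum>k\<in>K. \<Sum>j\<in>J. \<Sum>l\<in>L. h k l i j)"
    by (rule sum.cong[OF refl], rule sum.cong[OF refl], rule sum.swap)
  also have "\<dots> = (\<Sum>i\<in>I. \<Sum>j\<in>J. \<Sum>k\<in>K. \<Sum>l\<in>L. h k l i j)"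
    by (rule sum.cong[OF refl], rule sum.swap)
  finally show ?thesis .
qed

lemma form_correlation_pos_def:
  fixes F :: "'m::finite \<Rightarrow> real \<Rightarrow> complex" and v x :: "'k \<Rightarrow> real"
  assumes sq: "\<And>i. square_integrable_on (F i) UNIV"
    and psd: "pos_semidef_on UNIV (\<lambda>i j. A $ i $ j)"
  shows "0 \<le> (\<Sum>k\<in>I. \<Sum>l\<in>I. v k * Re (form_correlation A F (x k - x l)) * v l)"
proof -
  \<comment> \<open>The shift is \<open>x k\<close> here; the factor 2 of the overview enters when
    the points are instantiated.\<close>
  define G where "G i y = (\<Sum>k\<in>I. of_real (v k) * F i (y - x k))" for i y
  define q where "q k l y = (\<Sum>i\<in>UNIV. \<Sum>j\<in>UNIV.
      of_real (A $ i $ j) * (cnj (F i (y - x k)) * F j (y - x l)))" for k l y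
  have int: "integrable lebesgue (\<lambda>y. cnj (F i (y - x k)) * F j (y - x l))" for i j k l
    using integrable_correlation[OF sq sq, of i "- x k" j "- x l"] by simp
  have int_q: "integrable lebesgue (q k l)" for k l
    unfolding q_def using int by (intro Bochner_Integration.integrable_sum) auto
  have form: "form_correlation A F (x k - x l) = (LINT y|lebesgue. q k l y)" for k l
    unfolding form_correlation_def correlation_diff q_def using int
    by (simp add: Bochner_Integration.integral_sum)
  have sum_q: "(\<Sum>k\<in>I. \<Sum>l\<in>I. of_real (v k * v l) * q k l y) =
      (\<Sum>i\<in>UNIV. \<Sum>j\<in>UNIV. of_real (A $ i $ j) * (cnj (G i y) * G j y))" for y
  proof -
    have "(\<Sum>k\<in>I. \<Sum>l\<in>I. of_real (v k * v l) * q k l y) =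
        (\<Sum>k\<in>I. \<Sum>l\<in>I. \<Sum>i\<in>UNIV. \<Sum>j\<in>UNIV. of_real (v k * v l) *
          (of_real (A $ i $ j) * (cnj (F i (y - x k)) * F j (y - x l))))"
      by (simp add: q_def sum_distrib_left)
    also have "\<dots> = (\<Sum>i\<in>UNIV. \<Sum>j\<in>UNIV. \<Sum>k\<in>I. \<Sum>l\<in>I. of_real (v k * v l) *
          (of_real (A $ i $ j) * (cnj (F i (y - x k)) * F j (y - x l))))"
      by (rule sum_swap_pairs)
    \<comment> \<open>For fixed \<open>i\<close> and \<open>j\<close> the sum over \<open>k\<close>
      and \<open>l\<close> is a product; \<open>cnj\<close> passes through the weights because they
      are real.\<close>
    also have "\<dots> = (\<Sum>i\<in>UNIV. \<Sum>j\<in>UNIV. of_real (A $ i $ j) * (cnj (G i y) * G j y))"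
      by (intro sum.cong refl)
        (simp add: G_def sum_product sum_distrib_left mult_ac)
    finally show ?thesis .
  qed
  have "(\<Sum>k\<in>I. \<Sum>l\<in>I. v k * Re (form_correlation A F (x k - x l)) * v l) =
      Re (\<Sum>k\<in>I. \<Sum>l\<in>I. of_real (v k * v l) * form_correlation A F (x k - x l))"
    by (simp add: mult_ac)
  also have "(\<Sum>k\<in>I. \<Sum>l\<in>I. of_real (v k * v l) * form_correlation A F (x k - x l)) =
      (LINT y|lebesgue. (\<Sum>k\<in>I. \<Sum>l\<in>I. of_real (v k * v l) * q k l y))"
    using int_q by (simp add: form Bochner_Integration.integral_sum del: of_real_mult)
  also have "Re \<dots> = (LINT y|lebesgue. Re (\<Sum>k\<in>I. \<Sum>l\<in>I. of_real (v k * v l) * q k l y))"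
    using int_q by (intro integral_Re[symmetric] Bochner_Integration.integrable_sum) auto
  also have "\<dots> \<ge> 0"
    unfolding sum_q using pos_semidef_on_complex[OF psd]
    by (intro Bochner_Integration.integral_nonneg)
  finally show ?thesis .
qed

text \<open>The trace pairs \<open>A\<close> with the transpose of \<open>Phi\<close>, which the
  symmetry of \<open>A\<close> turns into an entrywise pairing. The terms at \<open>2 * t\<close>
  and \<open>- (2 * t)\<close> are conjugate, so their average is a real part.\<close>

lemma trace_kernel_eq:
  fixes \<phi> :: "'m::finite \<Rightarrow> real \<Rightarrow> complex"
  assumes "\<And>i. square_integrable_on (\<phi> i) {-1..1}" and sym: "\<And>i j. A $ i $ j = A $ j $ i"
  shows "trace_kernel \<phi> A t =
    of_real (Re (form_correlation A (\<lambda>i x. indicator {-1..1} x *\<^sub>R \<phi> i x) (2 * t)))"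
proof -
  let ?F = "\<lambda>i x. indicator {-1..1} x *\<^sub>R \<phi> i x"
  have "trace_kernel \<phi> A t = (\<Sum>i\<in>UNIV. \<Sum>j\<in>UNIV. of_real (A $ j $ i) * Phi \<phi> t $ j $ i)"
    by (simp add: trace_kernel_def trace_def matrix_matrix_mult_def sym)
  also have "\<dots> = (\<Sum>j\<in>UNIV. \<Sum>i\<in>UNIV. of_real (A $ j $ i) * Phi \<phi> t $ j $ i)"
    by (rule sum.swap)
  also have "\<dots> = (form_correlation A ?F (2 * t) + form_correlation A ?F (- (2 * t))) / 2"
    unfolding Phi_eq_correlation[OF assms(1)] form_correlation_def
    by (simp add: sum.distrib[symmetric] sum_divide_distrib ring_distribs)
  also have "\<dots> = of_real (Re (form_correlation A ?F (2 * t)))"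
    unfolding cnj_form_correlation[OF sym, symmetric] complex_add_cnj by simp
  finally show ?thesis .
qed

theorem theorem1:
  fixes \<phi> :: "'m::finite \<Rightarrow> real \<Rightarrow> complex"
    and A :: "real^'m^'m"
  assumes "\<And>i. square_integrable_on (\<phi> i) {-1..1}"
    and "pos_semidef_on UNIV (\<lambda>i j. A $ i $ j)"
  shows "(\<forall>t. trace_kernel \<phi> A t \<in> \<real>) \<and>
         pos_def_kernel (\<lambda>t. Re (trace_kernel \<phi> A t)) \<and>
         (\<forall>t. t \<notin> {-1..1} \<longrightarrow> trace_kernel \<phi> A t = 0)"
proof (intro conjI allI impI)
  let ?F = "\<lambda>i x. indicator {-1..1} x *\<^sub>R \<phi> i x"
  have sym: "\<And>i j. A $ i $ j = A $ j $ i"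
    using assms(2) by (auto simp: pos_semidef_on_def)
  note K = trace_kernel_eq[OF assms(1) sym]
  show "trace_kernel \<phi> A t \<in> \<real>" for t
    by (simp add: K)
  \<comment> \<open>Symmetry of the kernel matrices: negating the lag conjugates \<open>B\<close>,
    which leaves the real part unchanged.\<close>
  have "Re (form_correlation A ?F (2 * (s - t))) = Re (form_correlation A ?F (2 * (t - s)))" for s t
    using arg_cong[OF cnj_form_correlation[OF sym, of ?F "2 * (s - t)"], of Re] by simp
  \<comment> \<open>The points are doubled because the kernel evaluates \<open>B\<close> at
    \<open>2 * t\<close>.\<close>
  moreover have "0 \<le> (\<Sum>k<n. \<Sum>l<n. v k * Re (form_correlation A ?F (2 * (x k - x l))) * v l)"
    for n and v x :: "nat \<Rightarrow> real"
    using form_correlation_pos_def[OF square_integrable_on_UNIV_zero_extension[OF assms(1)] assms(2),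
        where I = "{..<n}" and v = v and x = "\<lambda>k. 2 * x k"]
    by (simp add: right_diff_distrib)
  ultimately show "pos_def_kernel (\<lambda>t. Re (trace_kernel \<phi> A t))"
    unfolding pos_def_kernel_def pos_semidef_on_def K Re_complex_of_real by blast
  show "trace_kernel \<phi> A t = 0" if "t \<notin> {-1..1}" for t
  proof -
    have "correlation (?F i) (?F j) (2 * t) = 0" for i j
      using that by (intro correlation_eq_0) auto
    then show ?thesis
      by (simp add: K form_correlation_def)
  qed
qed

end
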